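(* There exists a residuated lattice $A$ that satisfies $\neg a\vee\neg\neg a=1$ for all $a\in A$ and that is not co-Stone.
   Context: A residuated lattice is an algebra $(A,\vee,\wedge,\odot,\rightarrow,0,1)$ such that $(A,\vee,\wedge,0,1)$ is a bounded lattice, $(A,\odot,1)$ is a commutative monoid, and $a\leq b\rightarrow c$ iff $a\odot b\leq c$ for all $a,b,c\in A$. $\neg a=a\rightarrow 0$. A filter of $A$ is a non-empty upward closed subset closed under $\odot$; $\langle x\rangle$ is the filter generated by $x$. $B(A)$ is the set of complemented elements of the bounded lattice $A$, and $x^{\top}=\{a\in A\mid a\vee x=1\}$. $A$ is co-Stone iff for all $x\in A$ there exists $e\in B(A)$ with $x^{\top}=\langle e\rangle$. *)

theory Defs
  imports "HOL-Algebra.Group"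
begin

text \<open>
  The lattice part of a residuated lattice is presented by its order, as in the library locale
  \<^locale>\<open>bounded_lattice\<close>: the operations \<open>\<squnion>\<close>, \<open>\<sqinter>\<close>, \<open>\<bottom>\<close>, \<open>\<top>\<close> are those determined by the order
  of the underlying \<^typ>\<open>'a gorder\<close>, and \<open>0\<close>, \<open>1\<close> are \<open>\<bottom>\<close>, \<open>\<top>\<close>.
\<close>

record 'a residuated_struct = "'a gorder" +
  tensor :: "'a \<Rightarrow> 'a \<Rightarrow> 'a" (infixl \<open>\<odot>\<index>\<close> 70)
  residuum :: "'a \<Rightarrow> 'a \<Rightarrow> 'a" (infixr \<open>\<leadsto>\<index>\<close> 66)

locale residuated_lattice = bounded_lattice A for A (structure) +
  assumes tensor_comm_monoid:
      "comm_monoid \<lparr>carrier = carrier A, mult = tensor A, one = \<top>\<rparr>"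
    and residuum_closed:
      "\<lbrakk>a \<in> carrier A; b \<in> carrier A\<rbrakk> \<Longrightarrow> a \<leadsto> b \<in> carrier A"
    and residuation:
      "\<lbrakk>a \<in> carrier A; b \<in> carrier A; c \<in> carrier A\<rbrakk> \<Longrightarrow>
        a \<sqsubseteq> (b \<leadsto> c) \<longleftrightarrow> (a \<odot> b) \<sqsubseteq> c"

definition rl_neg :: "('a, 'b) residuated_struct_scheme \<Rightarrow> 'a \<Rightarrow> 'a"
  where "rl_neg A a = a \<leadsto>\<^bsub>A\<^esub> \<bottom>\<^bsub>A\<^esub>"

definition rl_filter :: "('a, 'b) residuated_struct_scheme \<Rightarrow> 'a set \<Rightarrow> bool"
  where "rl_filter A F \<longleftrightarrow>
    F \<subseteq> carrier A \<and> F \<noteq> {} \<and>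
    (\<forall>a\<in>F. \<forall>b\<in>carrier A. a \<sqsubseteq>\<^bsub>A\<^esub> b \<longrightarrow> b \<in> F) \<and>
    (\<forall>a\<in>F. \<forall>b\<in>F. a \<odot>\<^bsub>A\<^esub> b \<in> F)"

definition generated_filter :: "('a, 'b) residuated_struct_scheme \<Rightarrow> 'a \<Rightarrow> 'a set"
  where "generated_filter A x = \<Inter> {F. rl_filter A F \<and> x \<in> F}"

definition complemented_elements :: "('a, 'b) gorder_scheme \<Rightarrow> 'a set"
  where "complemented_elements A =
    {e \<in> carrier A. \<exists>f\<in>carrier A. e \<squnion>\<^bsub>A\<^esub> f = \<top>\<^bsub>A\<^esub> \<and> e \<sqinter>\<^bsub>A\<^esub> f = \<bottom>\<^bsub>A\<^esub>}"

definition coannihilator :: "('a, 'b) gorder_scheme \<Rightarrow> 'a \<Rightarrow> 'a set"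
  where "coannihilator A x = {a \<in> carrier A. a \<squnion>\<^bsub>A\<^esub> x = \<top>\<^bsub>A\<^esub>}"

definition co_Stone :: "('a, 'b) residuated_struct_scheme \<Rightarrow> bool"
  where "co_Stone A \<longleftrightarrow>
    (\<forall>x\<in>carrier A. \<exists>e\<in>complemented_elements A. coannihilator A x = generated_filter A e)"

end

theory Submission
  imports Defs
begin

text \<open>
  A new least element under the four-element Boolean lattice \<open>m < p, q < 1\<close> gives a five-element
  Heyting algebra, i.e. a residuated lattice whose product is the meet. Every nonzero element has
  pseudocomplement \<open>0\<close>, so \<open>\<not>a \<or> \<not>\<not>a = 1\<close> holds. As \<open>0\<close> is meet-irreducible, only
  \<open>0\<close> and \<open>1\<close> are complemented, and they generate the improper and the trivial filter; but the
  coannihilator of \<open>p\<close> is \<open>{q, 1}\<close>.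
\<close>

text \<open>The codes follow a linear extension of the order, so only the incomparable pair 2, 3
  must be removed from \<open><\<close>, and meets and joins are \<open>min\<close> and
  \<open>max\<close> off that pair.\<close>

definition five_le :: "nat \<Rightarrow> nat \<Rightarrow> bool"
  where "five_le a b \<longleftrightarrow> a = b \<or> a < b \<and> \<not> (a = 2 \<and> b = 3)"

definition five_meet :: "nat \<Rightarrow> nat \<Rightarrow> nat"
  where "five_meet a b = (if a = 2 \<and> b = 3 \<or> a = 3 \<and> b = 2 then 1 else min a b)"

definition five_join :: "nat \<Rightarrow> nat \<Rightarrow> nat"
  where "five_join a b = (if a = 2 \<and> b = 3 \<or> a = 3 \<and> b = 2 then 4 else max a b)"

text \<open>This is the relative pseudocomplement. On codes, the last branch leaves only
  \<open>a\<close> in {2, 3}, and \<open>5 - a\<close> is then the other of the two.\<close>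

definition five_imp :: "nat \<Rightarrow> nat \<Rightarrow> nat"
  where "five_imp a b =
    (if five_le a b then 4 else if b = 0 \<or> a = 4 then b else 5 - a)"

text \<open>The elements \<open>0, m, p, q, 1\<close> are coded by \<open>0, 1, 2, 3, 4\<close>.\<close>

definition five :: "nat residuated_struct"
  where "five = \<lparr>carrier = {0, 1, 2, 3, 4}, eq = (=), le = five_le,
    tensor = five_meet, residuum = five_imp\<rparr>"

lemma five_simps [simp]:
  "carrier five = {0, 1, 2, 3, 4}" "eq five = (=)" "le five = five_le"
  "tensor five = five_meet" "residuum five = five_imp"
  by (simp_all add: five_def)

lemma five_meet_closed:
  "a \<in> carrier five \<Longrightarrow> b \<in> carrier five \<Longrightarrow> five_meet a b \<in> carrier five"
  by (auto simp: five_meet_def)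

lemma five_imp_closed:
  "a \<in> carrier five \<Longrightarrow> b \<in> carrier five \<Longrightarrow> five_imp a b \<in> carrier five"
  by (auto simp: five_imp_def five_le_def)

lemma five_join_closed:
  "a \<in> carrier five \<Longrightarrow> b \<in> carrier five \<Longrightarrow> five_join a b \<in> carrier five"
  by (auto simp: five_join_def)

lemma five_le_refl: "five_le a a"
  by (simp add: five_le_def)

lemma five_le_trans:
  assumes "a \<in> carrier five" "b \<in> carrier five" "c \<in> carrier five"
  shows "five_le a b \<Longrightarrow> five_le b c \<Longrightarrow> five_le a c"
  using assms unfolding five_simps
  by (elim insertE emptyE; simp add: five_le_def)

text \<open>One equivalence carries the whole universal property: taking \<open>c\<close> to be the
  join gives the upper bounds, and the direction from right to left gives leastness.\<close>

lemma five_join_le_iff: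
  assumes "a \<in> carrier five" "b \<in> carrier five" "c \<in> carrier five"
  shows "five_le (five_join a b) c \<longleftrightarrow> five_le a c \<and> five_le b c"
  using assms unfolding five_simps
  by (elim insertE emptyE; simp add: five_le_def five_join_def)

lemma five_le_meet_iff:
  assumes "a \<in> carrier five" "b \<in> carrier five" "c \<in> carrier five"
  shows "five_le c (five_meet a b) \<longleftrightarrow> five_le c a \<and> five_le c b"
  using assms unfolding five_simps
  by (elim insertE emptyE; simp add: five_le_def five_meet_def)

lemma least_five_join:
  assumes "a \<in> carrier five" "b \<in> carrier five"
  shows "least five (five_join a b) (Upper five {a, b})"
  using assms five_join_closed[OF assms] five_join_le_iff[OF assms] five_le_refl
  \<comment> \<open>Membership in the carrier is kept folded so that the hypotheses of the
    equivalence match.\<close>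
  by (intro least_UpperI) (auto simp: Upper_def simp del: five_simps(1))

lemma greatest_five_meet:
  assumes "a \<in> carrier five" "b \<in> carrier five"
  shows "greatest five (five_meet a b) (Lower five {a, b})"
  using assms five_meet_closed[OF assms] five_le_meet_iff[OF assms] five_le_refl
  by (intro greatest_LowerI) (auto simp: Lower_def simp del: five_simps(1))

lemma least_five: "least five 0 (carrier five)"
  by (auto simp: least_def five_le_def)

lemma greatest_five: "greatest five 4 (carrier five)"
  by (auto simp: greatest_def five_le_def)

lemma five_partial_order: "partial_order five"
  by unfold_locales
    (simp_all add: five_le_refl del: five_simps(1), auto simp: five_le_def intro: five_le_trans)

interpretation five_order: partial_order five
  by (rule five_partial_order)

interpretation five_lattice: bounded_lattice five
proof unfold_locales
  show "\<exists>s. least five s (Upper five {a, b})" if "a \<in> carrier five" "b \<in> carrier five" for a b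
    using least_five_join[OF that] by (rule exI)
  show "\<exists>s. greatest five s (Lower five {a, b})" if "a \<in> carrier five" "b \<in> carrier five" for a b
    using greatest_five_meet[OF that] by (rule exI)
  show "\<exists>x. least five x (carrier five)"
    using least_five by (rule exI)
  show "\<exists>x. greatest five x (carrier five)"
    using greatest_five by (rule exI)
qed

text \<open>Least elements are unique up to \<open>eq five\<close>, which is equality.\<close>

lemma five_bottom: "\<bottom>\<^bsub>five\<^esub> = 0"
  using five_lattice.bottom_least least_five five_order.weak_least_unique by fastforce

lemma five_top: "\<top>\<^bsub>five\<^esub> = 4"
  using five_lattice.top_greatest greatest_five five_order.weak_greatest_unique by fastforce

lemma five_join_eq:
  assumes "a \<in> carrier five" "b \<in> carrier five"
  shows "a \<squnion>\<^bsub>five\<^esub> b = five_join a b"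
  \<comment> \<open>The lattice join is a \<open>SOME\<close>-choice of a supremum; existence makes
    the choice a supremum, and uniqueness identifies it with \<open>five_join\<close>.\<close>
  using someI[of "\<lambda>s. least five s (Upper five {a, b})", OF least_five_join[OF assms]]
    least_five_join[OF assms] five_order.weak_least_unique
  unfolding join_def sup_def by fastforce

lemma five_meet_eq:
  assumes "a \<in> carrier five" "b \<in> carrier five"
  shows "a \<sqinter>\<^bsub>five\<^esub> b = five_meet a b"
  using someI[of "\<lambda>s. greatest five s (Lower five {a, b})", OF greatest_five_meet[OF assms]]
    greatest_five_meet[OF assms] five_order.weak_greatest_unique
  unfolding meet_def inf_def by fastforce

lemma five_meet_assoc:
  assumes "a \<in> carrier five" "b \<in> carrier five" "c \<in> carrier five"
  shows "five_meet (five_meet a b) c = five_meet a (five_meet b c)"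
  using assms unfolding five_simps
  by (elim insertE emptyE; simp add: five_meet_def)

lemma five_meet_commute: "five_meet a b = five_meet b a"
  by (auto simp: five_meet_def)

lemma five_meet_top: "a \<in> carrier five \<Longrightarrow> five_meet 4 a = a"
  by (auto simp: five_meet_def)

lemma five_residuation:
  assumes "a \<in> carrier five" "b \<in> carrier five" "c \<in> carrier five"
  shows "five_le a (five_imp b c) \<longleftrightarrow> five_le (five_meet a b) c"
  using assms unfolding five_simps
  by (elim insertE emptyE; simp add: five_imp_def five_le_def five_meet_def)

lemma five_comm_monoid: "comm_monoid \<lparr>carrier = carrier five, mult = five_meet, one = 4\<rparr>"
  by (rule comm_monoidI)
    (simp_all add: five_meet_closed five_meet_assoc five_meet_top five_meet_commute[of _ 4]
      del: five_simps(1), simp_all add: five_meet_commute)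

lemma five_residuated_lattice: "residuated_lattice five"
proof (intro residuated_lattice.intro residuated_lattice_axioms.intro)
  show "bounded_lattice five"
    by (rule five_lattice.bounded_lattice_axioms)
qed (simp_all add: five_comm_monoid five_imp_closed five_residuation five_top del: five_simps(1))

text \<open>Negation takes only the values 0 and 4 and swaps them, so one of the two joinands is
  always the top.\<close>

lemma five_neg_join_neg_neg:
  assumes "a \<in> carrier five"
  shows "rl_neg five a \<squnion>\<^bsub>five\<^esub> rl_neg five (rl_neg five a) = \<top>\<^bsub>five\<^esub>"
proof -
  have "rl_neg five x = (if x = 0 then 4 else 0)" for x
    by (simp add: rl_neg_def five_bottom five_imp_def five_le_def)
  then show ?thesis
    by (simp add: five_join_eq five_top five_join_def)
qed

text \<open>Since 2 and 3 meet in 1, a meet equal to 0 forces one of \<open>e\<close>,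
  \<open>f\<close> to be 0; the join condition then makes the other one 4.\<close>

lemma five_complemented_elements: "complemented_elements five \<subseteq> {0, 4}"
proof
  fix e assume "e \<in> complemented_elements five"
  then obtain f where "e \<in> carrier five" "f \<in> carrier five"
    "five_join e f = 4" "five_meet e f = 0"
    unfolding complemented_elements_def
    by (auto simp only: mem_Collect_eq five_join_eq five_meet_eq five_top five_bottom)
  then show "e \<in> {0, 4}"
    by (auto simp: five_join_def five_meet_def min_def max_def split: if_splits)
qed

lemma five_coannihilator: "coannihilator five 2 = {3, 4}"
proof -
  have "coannihilator five 2 = {a \<in> carrier five. five_join a 2 = 4}"
    unfolding coannihilator_def by (intro Collect_cong conj_cong) (simp_all add: five_join_eq five_top)
  then show ?thesis
    by (auto simp: five_join_def)
qed

text \<open>Excludes \<open>e = 0\<close> as a generator of {3, 4}.\<close>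

lemma zero_in_generated_filter: "0 \<in> generated_filter five 0"
  by (simp add: generated_filter_def)

text \<open>Excludes \<open>e = 4\<close>: the trivial filter {4} is one of the sets
  intersected.\<close>

lemma three_notin_generated_filter: "3 \<notin> generated_filter five 4"
proof -
  have "rl_filter five {4}"
    by (auto simp: rl_filter_def five_le_def five_meet_def)
  then show ?thesis
    by (auto simp: generated_filter_def)
qed

lemma five_not_co_Stone: "\<not> co_Stone five"
proof
  assume "co_Stone five"
  \<comment> \<open>The co-Stone condition is applied to the element coded by 2.\<close>
  then obtain e where "e \<in> complemented_elements five" "generated_filter five e = {3, 4}"
    unfolding co_Stone_def by (force simp flip: five_coannihilator)
  then show False
    using five_complemented_elements zero_in_generated_filter three_notin_generated_filter by auto
qed

theorem mainTheorem6:
  shows "\<exists>A :: nat residuated_struct.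
    residuated_lattice A \<and>
    (\<forall>a\<in>carrier A. rl_neg A a \<squnion>\<^bsub>A\<^esub> rl_neg A (rl_neg A a) = \<top>\<^bsub>A\<^esub>) \<and>
    \<not> co_Stone A"
  using five_residuated_lattice five_neg_join_neg_neg five_not_co_Stone by blast

end
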